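(* Let $P\geq 1$ be an integer. The semi-discrete scheme $$u^{n+1}-2u^{n}+u^{n-1} = \sum_{p=1}^{P} A_p(\beta)\,\mathcal{D}^{p}[u^n]$$ is unconditionally stable, provided that $0<\beta\leq\beta_{max}$, where $\beta_{max}$ is the first (smallest) positive root of the equation $$-\sum_{p=1}^P A_p(\beta_{max}) = 4.$$
   Context: The scheme approximates the one-dimensional wave equation $\frac{1}{c^2}u_{tt}=u_{xx}$, $x\in\mathbb{R}$ (free space), with wave speed $c>0$. Here $u^n=u^n(x)$ approximates $u(x,n\Delta t)$, where $\Delta t>0$ is the time step. For a parameter $\beta>0$, set $\alpha=\beta/(c\Delta t)$. Operators: $\mathcal{L}=1-\frac{1}{\alpha^2}\frac{\partial^2}{\partial x^2}$, whose inverse on $\mathbb{R}$ is $$\mathcal{L}^{-1}[u](x)=\frac{\alpha}{2}\int_{-\infty}^{\infty}e^{-\alpha|x-y|}u(y)\,dy,$$ and $\mathcal{D}[u](x)=u(x)-\mathcal{L}^{-1}[u](x)$; $\mathcal{D}^p$ is the $p$-fold composition. The Fourier symbol of $\mathcal{D}$ at wavenumber $k\in\mathbb{R}$ is $$\hat{D}=\frac{(k/\alpha)^2}{1+(k/\alpha)^2}\in[0,1).$$ Coefficients: for each integer $p\geq 1$, $$A_p(\beta) = 2\sum_{m=1}^p (-1)^m\frac{\beta^{2m}}{(2m)!}\binom{p-1}{m-1}.$$ Stability (Von Neumann, free space): taking the Fourier transform in $x$ and substituting $\hat{u}^n=\rho^n\hat{u}^0$ gives, for each $k$, the characteristic polynomial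 equation for the amplification factor $\rho\in\mathbb{C}$, $$\rho^2-2\rho+1=-\rho\,S(\beta,\hat{D}),\qquad S(\beta,\hat{D})=-\sum_{p=1}^P A_p(\beta)\hat{D}^p.$$ The scheme is called unconditionally stable (A-stable) for a given $\beta$ if, for every $\Delta t>0$ and every $k\in\mathbb{R}$, all roots $\rho$ of this equation satisfy $|\rho|\leq 1$. *)

theory Defs
  imports "HOL-Analysis.Analysis"
begin

section \<open>The semi-discrete scheme\<close>

text \<open>Grid functions are complex valued, so that plane waves are admissible data.\<close>

definition Linv :: "real \<Rightarrow> (real \<Rightarrow> complex) \<Rightarrow> real \<Rightarrow> complex" where
  "Linv \<alpha> u x = of_real (\<alpha> / 2) * (LINT y|lborel. of_real (exp (- \<alpha> * \<bar>x - y\<bar>)) * u y)"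

definition Dop :: "real \<Rightarrow> (real \<Rightarrow> complex) \<Rightarrow> real \<Rightarrow> complex" where
  "Dop \<alpha> u x = u x - Linv \<alpha> u x"

definition A_coeff :: "nat \<Rightarrow> real \<Rightarrow> real" where
  "A_coeff p \<beta> =
     2 * (\<Sum>m=1..p. (-1) ^ m * (\<beta> ^ (2 * m) / fact (2 * m)) * real ((p - 1) choose (m - 1)))"

definition alpha :: "real \<Rightarrow> real \<Rightarrow> real \<Rightarrow> real" where
  "alpha c dt \<beta> = \<beta> / (c * dt)"

definition scheme :: "nat \<Rightarrow> real \<Rightarrow> real \<Rightarrow> real \<Rightarrow> (nat \<Rightarrow> real \<Rightarrow> complex) \<Rightarrow> bool" where
  "scheme P c dt \<beta> u \<longleftrightarrow>
     (\<forall>n\<ge>1. \<forall>x. u (n + 1) x - 2 * u n x + u (n - 1) x =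
        (\<Sum>p=1..P. of_real (A_coeff p \<beta>) * (Dop (alpha c dt \<beta>) ^^ p) (u n) x))"

section \<open>Von Neumann stability\<close>

definition D_hat :: "real \<Rightarrow> real \<Rightarrow> real" where
  "D_hat \<alpha> k = (k / \<alpha>)\<^sup>2 / (1 + (k / \<alpha>)\<^sup>2)"

definition S :: "nat \<Rightarrow> real \<Rightarrow> real \<Rightarrow> real" where
  "S P \<beta> d = - (\<Sum>p=1..P. A_coeff p \<beta> * d ^ p)"

definition char_eq :: "nat \<Rightarrow> real \<Rightarrow> real \<Rightarrow> real \<Rightarrow> real \<Rightarrow> complex \<Rightarrow> bool" where
  "char_eq P c dt \<beta> k \<rho> \<longleftrightarrow>
     \<rho>\<^sup>2 - 2 * \<rho> + 1 = - \<rho> * of_real (S P \<beta> (D_hat (alpha c dt \<beta>) k))"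

definition unconditionally_stable :: "nat \<Rightarrow> real \<Rightarrow> real \<Rightarrow> bool" where
  "unconditionally_stable P c \<beta> \<longleftrightarrow>
     (\<forall>dt>0. \<forall>k. \<forall>\<rho>. char_eq P c dt \<beta> k \<rho> \<longrightarrow> norm \<rho> \<le> 1)"

text \<open>The first positive root; lemma \<open>beta_max_first_root\<close> below shows that it exists.\<close>

definition beta_max :: "nat \<Rightarrow> real" where
  "beta_max P = (LEAST b. 0 < b \<and> - (\<Sum>p=1..P. A_coeff p b) = 4)"

section \<open>The characteristic equation comes from the scheme\<close>

lemma has_bochner_integral_exp_half_line:
  fixes z :: complex
  assumes "0 < Re z"
  shows "has_bochner_integral lborel (\<lambda>t::real. indicator {0::real<..} t *\<^sub>R exp (- (z * of_real t))) (1 / z)"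
proof -
  have [simp]: "z \<noteq> 0" using assms by auto
  have "integrable lebesgue (\<lambda>t::real. indicator {0..} t *\<^sub>R exp (- Re z * t))"
    using assms
    by (intro nonnegative_absolutely_integrable_1 [unfolded set_integrable_def]
        integrable_on_exp_minus_to_infinity) auto
  then have "integrable lborel (\<lambda>t::real. indicator {0..} t *\<^sub>R exp (- Re z * t))"
    by (subst (asm) integrable_completion) auto
  then have int: "integrable lborel (\<lambda>t::real. indicator {0::real<..} t *\<^sub>R exp (- (z * of_real t)))"
    by (rule Bochner_Integration.integrable_bound) (auto simp: indicator_def)
  have lim0: "((\<lambda>t::real. - exp (- (z * of_real t)) / z) \<longlongrightarrow> - 1 / z) (at_right 0)"
    by (rule tendsto_eq_intros refl | simp)+
  have "((\<lambda>t::real. exp (- Re z * t)) \<longlongrightarrow> 0) at_top"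
    using assms
    by (intro filterlim_compose[OF exp_at_bot] filterlim_tendsto_neg_mult_at_bot[OF tendsto_const])
       (auto simp: filterlim_ident)
  then have "((\<lambda>t::real. exp (- (z * of_real t))) \<longlongrightarrow> 0) at_top"
    by (subst tendsto_norm_zero_iff[symmetric]) simp
  then have liminf: "((\<lambda>t::real. - exp (- (z * of_real t)) / z) \<longlongrightarrow> 0) at_top"
    using tendsto_divide[OF tendsto_minus tendsto_const[of z]] by fastforce
  have "(LBINT t=ereal 0..\<infinity>. exp (- (z * complex_of_real t))) = 0 - (- 1 / z)"
  proof (rule interval_integral_FTC_integrable[where F = "\<lambda>t. - exp (- (z * of_real t)) / z"])
    show "((\<lambda>t. - exp (- (z * of_real t)) / z) has_vector_derivative exp (- (z * of_real x))) (at x)"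
      for x :: real
      by (rule has_vector_derivative_real_field[where f = "\<lambda>t. - exp (- (z * t)) / z"])
         (auto intro!: derivative_eq_intros)
    show "set_integrable lborel (einterval (ereal 0) \<infinity>) (\<lambda>t. exp (- (z * complex_of_real t)))"
      using int by (simp add: set_integrable_def)
    show "(((\<lambda>t. - exp (- (z * of_real t)) / z) \<circ> real_of_ereal) \<longlongrightarrow> - 1 / z) (at_right (ereal 0))"
      using lim0 by (simp add: ereal_tendsto_simps)
    show "(((\<lambda>t. - exp (- (z * of_real t)) / z) \<circ> real_of_ereal) \<longlongrightarrow> 0) (at_left \<infinity>)"
      using liminf by (simp add: ereal_tendsto_simps)
  qed (auto intro!: continuous_intros)
  then show ?thesis
    using int by (simp add: has_bochner_integral_iff interval_integral_to_infinity_eq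
        set_lebesgue_integral_def)
qed

lemma Linv_plane_wave:
  assumes "0 < \<alpha>"
  shows "Linv \<alpha> (\<lambda>y. a * cis (k * y)) x = of_real (1 / (1 + (k / \<alpha>)\<^sup>2)) * (a * cis (k * x))"
proof -
  define z where "z = Complex \<alpha> (- k)"
  define w where "w = Complex \<alpha> k"
  have nz: "z \<noteq> 0" "w \<noteq> 0" using assms by (auto simp: z_def w_def complex_eq_iff)
  let ?f = "\<lambda>t::real. of_real (exp (- \<alpha> * \<bar>t\<bar>)) * cis (k * t)"
  have 1: "has_bochner_integral lborel (\<lambda>t::real. indicator {0::real<..} t *\<^sub>R exp (- (z * of_real t))) (1 / z)"
    by (rule has_bochner_integral_exp_half_line) (simp add: z_def assms)
  have 2: "has_bochner_integral lborel (\<lambda>t::real. indicator {0::real<..} t *\<^sub>R exp (- (w * of_real t))) (1 / w)"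
    by (rule has_bochner_integral_exp_half_line) (simp add: w_def assms)
  have 3: "has_bochner_integral lborel (\<lambda>t::real. indicator {0::real<..} (- t) *\<^sub>R exp (- (w * of_real (- t)))) (1 / w)"
    using 2 by (subst (asm) lborel_has_bochner_integral_real_affine_iff[where c = "-1" and t = 0]) auto
  have e: "of_real (exp (- \<alpha> * \<bar>t\<bar>)) * cis (k * t) =
      (indicator {0::real<..} t *\<^sub>R exp (- (z * of_real t)) + indicator {0::real<..} (- t) *\<^sub>R exp (- (w * of_real (- t))) :: complex)"
    if "t \<noteq> 0" for t :: real
    using that
    by (auto simp: indicator_def z_def w_def complex_eq_iff Re_exp Im_exp)
  have "has_bochner_integral lborel ?f (1 / z + 1 / w)"
    using has_bochner_integral_add[OF 1 3]
    by (rule has_bochner_integral_discrete_difference[where X = "{0}", THEN iffD1, rotated 4])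
       (auto simp: e[simplified])
  then have I: "(LINT t|lborel. ?f t) = 1 / z + 1 / w"
    by (rule has_bochner_integral_integral_eq)
  have "(LINT y|lborel. of_real (exp (- \<alpha> * \<bar>x - y\<bar>)) * (a * cis (k * y)))
      = (LINT t|lborel. (a * cis (k * x)) * ?f t)"
  proof (subst lborel_integral_real_affine[where c = 1 and t = x])
    have "of_real (exp (- \<alpha> * \<bar>x - (x + 1 * t)\<bar>)) * (a * cis (k * (x + 1 * t))) = (a * cis (k * x)) * ?f t"
      for t :: real
      by (simp add: distrib_left cis_mult[symmetric])
    then show "\<bar>1\<bar> *\<^sub>R (LINT t|lborel. of_real (exp (- \<alpha> * \<bar>x - (x + 1 * t)\<bar>)) * (a * cis (k * (x + 1 * t))))
        = (LINT t|lborel. (a * cis (k * x)) * ?f t)"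
      by (simp only: abs_one scaleR_one)
  qed simp
  also have "\<dots> = a * cis (k * x) * (1 / z + 1 / w)"
    by (simp only: integral_mult_right_zero I)
  finally have "Linv \<alpha> (\<lambda>y. a * cis (k * y)) x =
      of_real (\<alpha> / 2) * (1 / z + 1 / w) * (a * cis (k * x))"
    by (simp add: Linv_def)
  also have "of_real (\<alpha> / 2) * (1 / z + 1 / w) = of_real (1 / (1 + (k / \<alpha>)\<^sup>2))"
  proof -
    have "z * w = of_real (\<alpha>\<^sup>2 + k\<^sup>2)" "z + w = of_real (2 * \<alpha>)"
      by (auto simp: z_def w_def complex_eq_iff power2_eq_square)
    then have "1 / z + 1 / w = of_real (2 * \<alpha>) / of_real (\<alpha>\<^sup>2 + k\<^sup>2)"
      using nz by (metis add.commute add_divide_eq_iff divide_divide_eq_left' div_by_1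
          add_frac_eq mult.commute mult_1)
    moreover have "\<alpha> / 2 * (2 * \<alpha> / (\<alpha>\<^sup>2 + k\<^sup>2)) = 1 / (1 + (k / \<alpha>)\<^sup>2)"
      using assms by (simp add: field_simps power2_eq_square)
    ultimately show ?thesis by (metis of_real_divide of_real_mult)
  qed
  finally show ?thesis .
qed

lemma Dop_plane_wave:
  assumes "0 < \<alpha>"
  shows "(Dop \<alpha> ^^ p) (\<lambda>y. a * cis (k * y)) = (\<lambda>x. of_real (D_hat \<alpha> k ^ p) * (a * cis (k * x)))"
proof (induction p)
  case (Suc p)
  have nz: "1 + (k / \<alpha>)\<^sup>2 \<noteq> 0"
    by (smt (verit) zero_le_power2)
  have D: "D_hat \<alpha> k = 1 - 1 / (1 + (k / \<alpha>)\<^sup>2)"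
    using nz by (simp add: D_hat_def divide_simps)
  have "Dop \<alpha> (\<lambda>y. b * cis (k * y)) = (\<lambda>x. of_real (D_hat \<alpha> k) * (b * cis (k * x)))" for b
    unfolding D by (rule ext, simp only: Dop_def Linv_plane_wave[OF assms])
      (simp add: algebra_simps)
  from this[of "of_real (D_hat \<alpha> k ^ p) * a"] show ?case
    by (simp add: Suc.IH mult.assoc)
qed simp

lemma scheme_plane_wave_iff_char_eq:
  assumes "0 < c" "0 < dt" "0 < \<beta>"
  shows "scheme P c dt \<beta> (\<lambda>n x. \<rho> ^ n * cis (k * x)) \<longleftrightarrow> char_eq P c dt \<beta> k \<rho>"
proof -
  define s where "s = S P \<beta> (D_hat (alpha c dt \<beta>) k)"
  have a: "0 < alpha c dt \<beta>" using assms by (simp add: alpha_def)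
  have R: "(\<Sum>p=1..P. of_real (A_coeff p \<beta>) * (Dop (alpha c dt \<beta>) ^^ p) (\<lambda>x. \<rho> ^ n * cis (k * x)) x)
      = - (\<rho> ^ n * of_real s * cis (k * x))" for n x
    unfolding s_def S_def Dop_plane_wave[OF a]
    by (simp add: sum_distrib_left sum_distrib_right mult_ac)
  have E: "\<rho> ^ (n + 1) * cis (k * x) - 2 * (\<rho> ^ n * cis (k * x)) + \<rho> ^ (n - 1) * cis (k * x)
      = - (\<rho> ^ n * of_real s * cis (k * x)) \<longleftrightarrow>
      \<rho> ^ (n - 1) * (\<rho>\<^sup>2 - 2 * \<rho> + 1 + \<rho> * of_real s) = 0" if n: "1 \<le> n" for n x
  proof -
    obtain m where m: "n = Suc m" using n by (cases n) auto
    have "\<rho> ^ (n + 1) * cis (k * x) - 2 * (\<rho> ^ n * cis (k * x)) + \<rho> ^ (n - 1) * cis (k * x)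
        + \<rho> ^ n * of_real s * cis (k * x)
        = cis (k * x) * (\<rho> ^ (n - 1) * (\<rho>\<^sup>2 - 2 * \<rho> + 1 + \<rho> * of_real s))"
      by (simp add: m algebra_simps power2_eq_square)
    then show ?thesis
      by (metis (no_types, lifting) ab_group_add_class.ab_left_minus add_eq_0_iff cis_neq_zero
          mult_eq_0_iff mult_minus_left)
  qed
  have C: "char_eq P c dt \<beta> k \<rho> \<longleftrightarrow> \<rho>\<^sup>2 - 2 * \<rho> + 1 + \<rho> * of_real s = 0"
    unfolding char_eq_def s_def by (simp add: eq_neg_iff_add_eq_0)
  show ?thesis
    unfolding scheme_def R C using E
    by (metis (no_types, lifting) diff_self_eq_0 le_refl mult_1 mult_zero_right power_0)
qed

section \<open>Existence of the first positive root\<close>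

lemma alternating_sum_bounds:
  fixes a :: "nat \<Rightarrow> real"
  assumes "\<And>j. 0 \<le> a j" "\<And>j. a (Suc j) \<le> a j"
  shows "0 \<le> (\<Sum>j<n. (-1) ^ j * a j) \<and> (\<Sum>j<n. (-1) ^ j * a j) \<le> a 0"
  using assms
proof (induction n arbitrary: a)
  case (Suc n)
  have "0 \<le> (\<Sum>j<n. (-1) ^ j * a (Suc j)) \<and> (\<Sum>j<n. (-1) ^ j * a (Suc j)) \<le> a (Suc 0)"
    by (rule Suc.IH[of "\<lambda>j. a (Suc j)"]) (use Suc.prems in auto)
  moreover have "(\<Sum>j<Suc n. (-1) ^ j * a j) = a 0 - (\<Sum>j<n. (-1) ^ j * a (Suc j))"
    by (subst sum.lessThan_Suc_shift) (simp add: sum_negf)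
  ultimately show ?case using Suc.prems(2)[of 0] by linarith
qed simp

lemma A_coeff_upper:
  assumes "\<beta>\<^sup>2 * real (p - 1) \<le> 12" "1 \<le> p"
  shows "A_coeff p \<beta> \<le> - \<beta>\<^sup>2 + \<beta> ^ 4 / 12 * real (p - 1)"
proof -
  define a where "a j = 2 * \<beta> ^ (2 * Suc j) / fact (2 * Suc j) * real ((p - 1) choose j)" for j
  have nonneg: "0 \<le> a j" for j
    by (auto simp: a_def power_even_eq intro!: divide_nonneg_nonneg mult_nonneg_nonneg simp del: power_Suc mult_Suc_right fact_Suc)
  have ch: "real ((p - 1) choose Suc j) \<le> real (p - 1) * real ((p - 1) choose j)" for j
  proof -
    have "Suc j * ((p - 1) choose Suc j) = ((p - 1) choose j) * (p - 1 - j)"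
      using binomial_absorb_comp[of "p - 1" j] binomial_absorption[of j "p - 1"]
        choose_mult_lemma
      by (cases "j \<le> p - 1")
         (metis Suc_times_binomial_eq binomial_absorption binomial_absorb_comp mult.commute, simp)
    moreover have "\<dots> \<le> (p - 1) * ((p - 1) choose j)"
      by (metis diff_le_self mult.commute mult_le_mono1)
    ultimately have "((p - 1) choose Suc j) \<le> (p - 1) * ((p - 1) choose j)"
      by (metis le_trans mult_le_mono1 nat_mult_1 Suc_le_mono le0 One_nat_def)
    then show ?thesis by (metis of_nat_le_iff of_nat_mult)
  qed
  have dec: "a (Suc j) \<le> a j" for j
  proof -
    have f: "fact (2 * Suc (Suc j)) = (real (2 * j + 4) * real (2 * j + 3)) * fact (2 * Suc j)"
      by (simp add: algebra_simps)
    have g: "12 \<le> real (2 * j + 4) * real (2 * j + 3)" by (simp add: algebra_simps)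
    have "a (Suc j) \<le> 2 * \<beta> ^ (2 * Suc (Suc j)) / fact (2 * Suc (Suc j)) *
        (real (p - 1) * real ((p - 1) choose j))"
      unfolding a_def by (intro mult_left_mono ch)
        (auto simp: power_even_eq intro!: divide_nonneg_nonneg mult_nonneg_nonneg simp del: power_Suc mult_Suc_right fact_Suc)
    also have "\<dots> = a j * (\<beta>\<^sup>2 * real (p - 1) / (real (2 * j + 4) * real (2 * j + 3)))"
      unfolding a_def f by (simp add: power2_eq_square mult_ac)
    also have "\<dots> \<le> a j * 1"
      using g assms(1) by (intro mult_left_mono nonneg) (simp add: divide_le_eq_1)
    finally show ?thesis by simp
  qed
  have "A_coeff p \<beta> = - (\<Sum>j<p. (-1) ^ j * a j)"
    unfolding A_coeff_def a_def One_nat_def sum.atLeast1_atMost_eq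
    by (simp add: sum_distrib_left sum_negf[symmetric] mult_ac)
  also obtain q where q: "p = Suc q" using assms(2) by (cases p) auto
  have "(\<Sum>j<p. (-1) ^ j * a j) = a 0 - (\<Sum>j<q. (-1) ^ j * a (Suc j))"
    unfolding q by (subst sum.lessThan_Suc_shift) (simp add: sum_negf)
  also have "(\<Sum>j<q. (-1) ^ j * a (Suc j)) \<le> a 1"
    using alternating_sum_bounds[of "\<lambda>j. a (Suc j)" q] nonneg dec by simp
  finally show ?thesis
    by (simp add: a_def fact_numeral eval_nat_numeral)
qed

lemma beta_max_first_root:
  assumes "1 \<le> P"
  shows "0 < beta_max P" "- (\<Sum>p=1..P. A_coeff p (beta_max P)) = 4"
    "\<And>b. 0 < b \<Longrightarrow> - (\<Sum>p=1..P. A_coeff p b) = 4 \<Longrightarrow> beta_max P \<le> b"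
proof -
  define f where "f b = - (\<Sum>p=1..P. A_coeff p b)" for b
  define b0 where "b0 = sqrt (12 / P)"
  have b0: "0 < b0" "b0\<^sup>2 = 12 / P" using assms by (auto simp: b0_def)
  have cont: "continuous_on A f" for A
    unfolding f_def A_coeff_def by (intro continuous_intros) auto
  have f0: "f 0 = 0"
    unfolding f_def A_coeff_def by (simp add: power_0_left)
  have "A_coeff p b0 \<le> - b0\<^sup>2 + b0 ^ 4 / 12 * real (p - 1)" if "p \<in> {1..P}" for p
    using that assms by (intro A_coeff_upper) (auto simp: b0 field_simps)
  then have "(\<Sum>p=1..P. A_coeff p b0) \<le> (\<Sum>p=1..P. - b0\<^sup>2 + b0 ^ 4 / 12 * real (p - 1))"
    by (rule sum_mono)
  also have "\<dots> = - P * b0\<^sup>2 + b0 ^ 4 / 12 * (\<Sum>p=1..P. real (p - 1))"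
    by (simp only: sum.distrib sum_distrib_left[symmetric] sum_constant) simp
  also have "(\<Sum>p=1..P. real (p - 1)) = real P * (real P - 1) / 2"
    by (induction P) (auto simp: field_simps)
  also have "b0 ^ 4 = (12 / P)\<^sup>2"
    using b0(2) by (metis mult_2 numeral_Bit0 power_add power2_eq_square)
  also have "- P * b0\<^sup>2 + (12 / P)\<^sup>2 / 12 * (real P * (real P - 1) / 2) \<le> - (4::real)"
  proof -
    have "real P * b0\<^sup>2 = 12" using assms by (simp add: b0(2))
    moreover have "(12 / real P)\<^sup>2 / 12 * (real P * (real P - 1) / 2) \<le> 6"
      using assms by (simp add: power2_eq_square field_simps)
    ultimately show ?thesis by simp
  qed
  finally have "4 \<le> f b0" by (simp add: f_def)
  then obtain r where r: "0 \<le> r" "f r = 4"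
    using IVT'[of f 0 4 b0] f0 b0 cont by auto
  define R where "R = {0..r} \<inter> f -` {4}"
  have "compact R"
    unfolding R_def compact_eq_bounded_closed
    by (auto intro!: continuous_closed_preimage cont intro: bounded_subset[OF bounded_closed_interval])
  then obtain m where m: "m \<in> R" "\<And>b. b \<in> R \<Longrightarrow> m \<le> b"
  proof -
    have "r \<in> R" using r by (simp add: R_def)
    then show ?thesis using compact_attains_inf[OF \<open>compact R\<close>] that by blast
  qed
  have "m \<noteq> 0" using m(1) f0 by (auto simp: R_def)
  then have m': "0 < m" "f m = 4" using m(1) by (auto simp: R_def)
  have least: "m \<le> b" if "0 < b" "f b = 4" for b
    using that m(2)[of b] m(1) by (cases "b \<le> r") (auto simp: R_def)
  have "beta_max P = m"
    unfolding beta_max_def f_def[symmetric] using m' least by (intro Least_equality) auto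
  then show "0 < beta_max P" "- (\<Sum>p=1..P. A_coeff p (beta_max P)) = 4"
    "\<And>b. 0 < b \<Longrightarrow> - (\<Sum>p=1..P. A_coeff p b) = 4 \<Longrightarrow> beta_max P \<le> b"
    using m' least by (auto simp: f_def)
qed

end

theory Submission
  imports Defs
begin

text \<open>
  The characteristic equation is \<open>\<rho>\<^sup>2 - (2 - s) \<rho> + 1 = 0\<close> with \<open>s\<close> real, so its roots lie on the unit
  circle as soon as \<open>0 \<le> s \<le> 4\<close>. The first root satisfies \<open>(beta_max P)\<^sup>2 \<le> 12 / P\<close>, and in the
  range \<open>\<beta>\<^sup>2 \<le> 12 / P\<close> each \<open>A_coeff p \<beta>\<close> with \<open>p \<le> P\<close> is nonpositive: its terms alternate in
  sign and decrease in size. Hence \<open>S P \<beta> d\<close> is nonnegative and increasing in \<open>d\<close>, and its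
  value at \<open>d = 1\<close> starts from 0 and cannot exceed 4 before the first root.
\<close>

text \<open>For a nonreal root the imaginary part forces \<open>2 - s = 2 * x\<close>, and the real
  part becomes \<open>x\<^sup>2 + y\<^sup>2 = 1\<close>. For a real root,
  \<open>\<bar>2 - s\<bar> \<le> 2\<close> leaves only \<open>\<bar>x\<bar> = 1\<close>.\<close>

lemma norm_le_1_if_char_poly_root:
  fixes \<rho> :: complex and s :: real
  assumes root: "\<rho>\<^sup>2 - 2 * \<rho> + 1 = - \<rho> * of_real s" and s: "0 \<le> s" "s \<le> 4"
  shows "norm \<rho> \<le> 1"
proof -
  define x where "x = Re \<rho>"
  define y where "y = Im \<rho>"
  have \<rho>: "\<rho> = Complex x y" by (simp add: x_def y_def)
  have re: "x\<^sup>2 - y\<^sup>2 + 1 = (2 - s) * x" and im: "(2 * x) * y = (2 - s) * y"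
    using root by (auto simp: \<rho> complex_eq_iff power2_eq_square algebra_simps)
  have "x\<^sup>2 + y\<^sup>2 \<le> 1"
  proof (cases "y = 0")
    case True
    have "(2 - s) * x \<le> \<bar>2 - s\<bar> * \<bar>x\<bar>" by (metis abs_ge_self abs_mult)
    also have "\<dots> \<le> 2 * \<bar>x\<bar>" using s by (intro mult_right_mono) auto
    finally have "(\<bar>x\<bar> - 1)\<^sup>2 \<le> 0" using re True by (simp add: power2_diff)
    then have "\<bar>x\<bar> = 1" by simp
    then show ?thesis using True by (simp add: power2_eq_1_iff abs_if split: if_splits)
  next
    case False
    then have "2 - s = 2 * x" using im by simp
    then show ?thesis using re by (simp add: power2_eq_square)
  qed
  then show ?thesis by (simp add: \<rho> complex_norm)
qed

lemma D_hat_bounds: "0 \<le> D_hat \<alpha> k" "D_hat \<alpha> k \<le> 1"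
  unfolding D_hat_def by (auto simp: divide_le_eq_1 add_pos_nonneg)

text \<open>\<open>S P b 1\<close> is continuous in \<open>b\<close> and vanishes at 0, so it takes
  the value 4 somewhere in \<open>{0<..b}\<close>.\<close>

lemma beta_max_le:
  assumes P: "1 \<le> P" and b: "0 \<le> b" "4 \<le> S P b 1"
  shows "beta_max P \<le> b"
proof -
  have "continuous_on {0..b} (\<lambda>b. S P b 1)"
    unfolding S_def A_coeff_def by (intro continuous_intros) auto
  moreover have "S P 0 1 = 0" by (simp add: S_def A_coeff_def power_0_left)
  ultimately obtain r where r: "0 \<le> r" "r \<le> b" "S P r 1 = 4"
    using IVT'[of "\<lambda>b. S P b 1" 0 4 b] b by auto
  have "r \<noteq> 0" using r(3) \<open>S P 0 1 = 0\<close> by auto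
  then have "beta_max P \<le> r"
    using r by (intro beta_max_first_root(3)[OF P]) (auto simp: S_def)
  then show ?thesis using r(2) by simp
qed

lemma beta_max_square_le:
  assumes P: "1 \<le> P"
  shows "(beta_max P)\<^sup>2 \<le> 12 / real P"
proof -
  \<comment> \<open>This choice gives \<open>b\<^sup>2 * real (p - 1) \<le> 12\<close> for all
    \<open>p \<le> P\<close>, as \<open>A_coeff_upper\<close> requires.\<close>
  define b where "b = sqrt (12 / real P)"
  have b: "0 \<le> b" "b\<^sup>2 = 12 / real P" by (auto simp: b_def)
  have b4: "b ^ 4 = (12 / real P)\<^sup>2" using b(2) power_mult[of b 2 2] by simp
  have "(\<Sum>p=1..P. A_coeff p b) \<le> (\<Sum>p=1..P. - b\<^sup>2 + b ^ 4 / 12 * real (p - 1))"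
    using P by (intro sum_mono A_coeff_upper) (auto simp: b field_simps)
  also have "\<dots> = - (real P * b\<^sup>2) + b ^ 4 / 12 * (\<Sum>p=1..P. real (p - 1))"
    by (simp only: sum.distrib sum_distrib_left[symmetric] sum_constant) simp
  also have "(\<Sum>p=1..P. real (p - 1)) = real P * (real P - 1) / 2"
    by (induction P) (auto simp: field_simps)
  \<comment> \<open>The left side equals -12 + 6 (P - 1) / P = -6 - 6 / P.\<close>
  also have "- (real P * b\<^sup>2) + b ^ 4 / 12 * (real P * (real P - 1) / 2) \<le> - 4"
    unfolding b b4 using P
    by (simp add: power2_eq_square field_simps order_trans[of "- (real P * 3)" 0 "real P * real P"])
  finally have "4 \<le> S P b 1" by (simp add: S_def)
  then have "beta_max P \<le> b" using beta_max_le[OF P b(1)] by simp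
  then show ?thesis
    using beta_max_first_root(1)[OF P] b(2) power_mono[of "beta_max P" b 2] by simp
qed

text \<open>In the bound of \<open>A_coeff_upper\<close> the quadratic term absorbs the quartic
  one.\<close>

lemma A_coeff_nonpos:
  assumes "1 \<le> p" "\<beta>\<^sup>2 * real (p - 1) \<le> 12"
  shows "A_coeff p \<beta> \<le> 0"
proof -
  have "\<beta>\<^sup>2 * (\<beta>\<^sup>2 * real (p - 1)) \<le> \<beta>\<^sup>2 * 12"
    using assms(2) by (intro mult_left_mono) auto
  then have "\<beta> ^ 4 / 12 * real (p - 1) \<le> \<beta>\<^sup>2"
    by (simp add: power2_eq_square power4_eq_xxxx mult_ac)
  then show ?thesis using A_coeff_upper[OF assms(2,1)] by linarith
qed

lemma S_bounds:
  assumes P: "1 \<le> P" and \<beta>: "0 < \<beta>" "\<beta> \<le> beta_max P" and d: "0 \<le> d" "d \<le> 1"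
  shows "0 \<le> S P \<beta> d" "S P \<beta> d \<le> 4"
proof -
  have A: "A_coeff p \<beta> \<le> 0" if p: "p \<in> {1..P}" for p
  proof (rule A_coeff_nonpos)
    have "\<beta>\<^sup>2 \<le> 12 / real P"
      using \<beta> beta_max_square_le[OF P] power_mono[of \<beta> "beta_max P" 2] by linarith
    then have "\<beta>\<^sup>2 * real (p - 1) \<le> 12 / real P * real P"
      using p by (intro mult_mono) auto
    then show "\<beta>\<^sup>2 * real (p - 1) \<le> 12" using P by simp
  qed (use p in auto)
  show "0 \<le> S P \<beta> d"
    unfolding S_def sum_negf[symmetric]
    using A d by (intro sum_nonneg) (simp add: mult_nonpos_nonneg)
  have "A_coeff p \<beta> * 1 ^ p \<le> A_coeff p \<beta> * d ^ p" if "p \<in> {1..P}" for p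
    using A[OF that] d by (intro mult_left_mono_neg) (auto simp: power_le_one)
  then have "S P \<beta> d \<le> S P \<beta> 1"
    unfolding S_def by (simp only: neg_le_iff_le sum_mono)
  also have "S P \<beta> 1 \<le> 4"
  proof (rule ccontr)
    assume "\<not> S P \<beta> 1 \<le> 4"
    \<comment> \<open>A value above 4 puts the first root at or below \<beta>, hence at \<beta>
      itself, where the value is exactly 4.\<close>
    then have "beta_max P = \<beta>" using beta_max_le[OF P, of \<beta>] \<beta> by simp
    then show False
      using \<open>\<not> S P \<beta> 1 \<le> 4\<close> beta_max_first_root(2)[OF P] by (simp add: S_def)
  qed
  finally show "S P \<beta> d \<le> 4" .
qed

theorem theorem3p2:
  fixes P :: nat and c \<beta> :: real
  assumes "P \<ge> 1" and "c > 0" and "0 < \<beta>" and "\<beta> \<le> beta_max P"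
  shows "unconditionally_stable P c \<beta>"
  unfolding unconditionally_stable_def char_eq_def
  using norm_le_1_if_char_poly_root S_bounds[OF assms(1,3,4) D_hat_bounds] by blast

end
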